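(* Let $\mathcal{D}$ be any normal and neutral domain and let $(\succ_i)_{i\in[n]}\in\mathcal{L}(\mathcal{A})^n$ be a profile over a set $\mathcal{A}$ of $m$ alternatives whose preference-distance from $\mathcal{D}$ is $\varepsilon_v n$. Let $0<\Delta<\min\{\varepsilon_v,1-\varepsilon_v\}$, let $0<\delta<1$, let $$\ell=\left\lceil\frac{4}{\Delta^2}\left(\mathrm{con}_{\mathcal{D}}(m)\,m!\,m\ln m+\ln\frac{1}{\delta}\right)\right\rceil,$$ and let $\succ'=(\succ'_i)_{i\in[\ell]}$ be a profile where each $\succ'_i$ is picked uniformly at random with replacement from the $n$ preferences of $(\succ_i)_{i\in[n]}$. Then, with probability at least $1-\delta$, the preference-distance of $\succ'$ from $\mathcal{D}$ is at least $(\varepsilon_v-\Delta)\ell$ and at most $(\varepsilon_v+\Delta)\ell$.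
   Context: $\mathcal{L}(\mathcal{A})$ is the set of linear orders (preferences) over a finite set $\mathcal{A}$ of $m$ alternatives; for $\mathcal{X}\subseteq\mathcal{A}$, $\succ(\mathcal{X})$ is the restriction of $\succ$ to $\mathcal{X}$. A profile is a tuple of preferences over $\mathcal{A}$. A domain $\mathcal{D}$ is a collection of subsets of $\bigcup_{|\mathcal{A}|>0}\mathcal{L}(\mathcal{A})$; a profile $\mathcal{P}$ of $n$ preferences belongs to $\mathcal{D}$ (written $\mathcal{P}\in\mathcal{D}$) if there is $\mathcal{B}\in\mathcal{D}$ with $\mathcal{P}\in\mathcal{B}^n$. $\mathcal{D}$ is neutral if membership of profiles in $\mathcal{D}$ is preserved under renaming the alternatives by any permutation (the same for all preferences of the profile). $\mathcal{D}$ is normal if $(\succ_i)_{i\in[n]}\in\mathcal{D}$ implies $(\succ_i(\mathcal{X}))_{i\in[n]}\in\mathcal{D}$ for every $\mathcal{X}\subseteq\mathcal{A}$. The content of $\mathcal{D}$ is the function $\mathrm{con}_{\mathcal{D}}:\mathbb{N}\to[0,1]$ such that $\mathrm{con}_{\mathcal{D}}(m)\,m!$ is the maximum number of distinct preferences in a profile over $m$ alternatives belonging to $\mathcal{D}$ (with $\mathrm{con}_{\mathcal{D}}(1)=1$). Preference-distance: the preference-distance of a profile $(\succ_i)_{i\in[n]}$ from $\mathcal{D}$ is $n-k$, where $k$ is the largest size of an index set $J\subseteq[n]$ with $(\succ_i)_{i\in J}\in\mathcal{D}$ (i.e. the minimum number of preferences to be deleted so that the remaining profile belongs to $\mathcal{D}$).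 *)

theory Defs
  imports "HOL-Probability.Probability" "HOL-Combinatorics.Permutations"
begin

text \<open>
  Preferences are encoded as reflexive linear orders: unlike a strict order on a singleton
  (which is the empty relation), such an order determines its set of alternatives.
\<close>

definition linear_orders :: "'a set \<Rightarrow> 'a rel set" where
  "linear_orders A = {r. linear_order_on A r}"

definition profile_on :: "'a set \<Rightarrow> 'a rel list \<Rightarrow> bool" where
  "profile_on A P \<longleftrightarrow> set P \<subseteq> linear_orders A"

definition preference_domain :: "'a rel set set \<Rightarrow> bool" where
  "preference_domain D \<longleftrightarrow> (\<forall>B\<in>D. B \<subseteq> (\<Union>A\<in>{A. finite A \<and> A \<noteq> {}}. linear_orders A))"

definition belongs_to :: "'a rel list \<Rightarrow> 'a rel set set \<Rightarrow> bool" where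
  "belongs_to P D \<longleftrightarrow> (\<exists>B\<in>D. P \<in> lists B)"

definition rename :: "('a \<Rightarrow> 'a) \<Rightarrow> 'a rel \<Rightarrow> 'a rel" where
  "rename p r = map_prod p p ` r"

definition neutral_domain :: "'a rel set set \<Rightarrow> bool" where
  "neutral_domain D \<longleftrightarrow>
     (\<forall>A P p. finite A \<and> A \<noteq> {} \<and> profile_on A P \<and> belongs_to P D \<and> p permutes A
        \<longrightarrow> belongs_to (map (rename p) P) D)"

text \<open>
  A domain contains preferences over nonempty sets of alternatives only, so normality ranges over
  the nonempty subsets \<open>X\<close> of \<open>A\<close>.
\<close>

definition normal_domain :: "'a rel set set \<Rightarrow> bool" where
  "normal_domain D \<longleftrightarrow>
     (\<forall>A P X. finite A \<and> A \<noteq> {} \<and> profile_on A P \<and> belongs_to P D \<and> X \<subseteq> A \<and> X \<noteq> {}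
        \<longrightarrow> belongs_to (map (\<lambda>r. r \<inter> X \<times> X) P) D)"

text \<open>
  In the next two definitions \<open>Sup\<close> is taken over a finite set of natural numbers, so it is
  the maximum. The set is empty only if \<open>D\<close> is empty or, for the content, if there are fewer
  than \<open>m\<close> alternatives in total or \<open>m = 0\<close>; then \<open>Sup {} = 0\<close>. That the
  content of 1 is 1 is a convention.
\<close>

definition domain_content :: "'a rel set set \<Rightarrow> nat \<Rightarrow> real" where
  "domain_content D m =
     (if m = 1 then 1
      else real (Sup {card (set P) | P A. finite A \<and> card A = m \<and> A \<noteq> {} \<and>
                                          profile_on A P \<and> belongs_to P D}) / fact m)"

definition preference_distance :: "'a rel set set \<Rightarrow> 'a rel list \<Rightarrow> nat" where
  "preference_distance D P =
     length P - Sup {card J | J. J \<subseteq> {..<length P} \<and> belongs_to (nths P J) D}"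

text \<open>
  The index, not the preference, is drawn uniformly, so a preference that occurs several times in
  the profile is weighted by its multiplicity.
\<close>

definition sample_profile :: "nat \<Rightarrow> 'a rel list \<Rightarrow> 'a rel list pmf" where
  "sample_profile l P = replicate_pmf l (map_pmf (\<lambda>i. P ! i) (pmf_of_set {..<length P}))"

end

theory Submission
  imports Defs
begin

text \<open>
  Deleting as few preferences as possible means keeping all preferences from some set \<open>S\<close> of
  preferences that is realised by a profile in \<open>D\<close>, so one minus the relative
  preference-distance is the maximum, over all such \<open>S\<close>, of the frequency of \<open>S\<close>
  in the profile. There are at most \<open>(m ^ m) ^ c\<close> relevant sets \<open>S\<close>, where
  \<open>c = con m * m!\<close>: each is the image of a \<open>c\<close>-tuple of linear orders. Hoeffding's
  inequality and a union bound over all \<open>S\<close> control the maximum from above; an optimal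
  \<open>S\<close> for the original profile alone controls it from below.
\<close>

section \<open>Largest subprofiles that belong to the domain\<close>

lemma belongs_to_iff: "belongs_to P D \<longleftrightarrow> (\<exists>B\<in>D. set P \<subseteq> B)"
  unfolding belongs_to_def by (auto simp: in_lists_conv_set)

lemma belongs_to_mono: "belongs_to P D \<Longrightarrow> set Q \<subseteq> set P \<Longrightarrow> belongs_to Q D"
  unfolding belongs_to_iff by blast

definition hits :: "'a set \<Rightarrow> 'a list \<Rightarrow> nat" where
  "hits S xs = length (filter (\<lambda>x. x \<in> S) xs)"

definition max_consistent :: "'a rel set set \<Rightarrow> 'a rel list \<Rightarrow> nat" where
  "max_consistent D P = Sup {card J | J. J \<subseteq> {..<length P} \<and> belongs_to (nths P J) D}"

lemma finite_consistent_sizes: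
  "finite {card J | J. J \<subseteq> {..<length P} \<and> belongs_to (nths P J) D}"
  by (rule finite_subset[of _ "card ` Pow {..<length P}"]) auto

text \<open>Membership in \<open>D\<close> depends only on the set of preferences used and passes to
  subsets, so all positions of \<open>P\<close> carrying a preference of \<open>xs\<close> may be
  kept together.\<close>

lemma hits_le_max_consistent:
  assumes "belongs_to xs D"
  shows "hits (set xs) P \<le> max_consistent D P"
proof -
  let ?J = "{i. i < length P \<and> P ! i \<in> set xs}"
  have "belongs_to (nths P ?J) D"
    by (rule belongs_to_mono[OF assms]) (auto simp: set_nths)
  moreover have "hits (set xs) P = card ?J"
    unfolding hits_def by (rule length_filter_conv_card)
  ultimately have "hits (set xs) P \<in> {card J | J. J \<subseteq> {..<length P} \<and> belongs_to (nths P J) D}"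
    by fastforce
  then show ?thesis
    unfolding max_consistent_def
    by (intro cSup_upper bdd_above_finite finite_consistent_sizes)
qed

text \<open>An optimal index set already contains every position whose preference it uses at all;
  otherwise adding the missing copies would enlarge it. This turns the maximum over index sets into
  one over sets of preferences.\<close>

lemma max_consistent_attained:
  assumes "D \<noteq> {}"
  obtains xs where "belongs_to xs D" "set xs \<subseteq> set P" "max_consistent D P = hits (set xs) P"
proof -
  let ?C = "{card J | J. J \<subseteq> {..<length P} \<and> belongs_to (nths P J) D}"
  have "belongs_to (nths P {}) D"
    using assms by (auto simp: belongs_to_iff)
  then have "?C \<noteq> {}" by blast
  then have "Max ?C \<in> ?C"
    using finite_consistent_sizes Max_in by blast
  moreover have "Sup ?C = Max ?C"
    using \<open>?C \<noteq> {}\<close> finite_consistent_sizes by (intro cSup_eq_Max)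
  ultimately obtain J where J: "J \<subseteq> {..<length P}" "belongs_to (nths P J) D"
    and eq: "max_consistent D P = card J"
    unfolding max_consistent_def by auto
  let ?xs = "nths P J"
  have "card J \<le> card {i. i < length P \<and> P ! i \<in> set ?xs}"
    using J(1) by (intro card_mono) (auto simp: set_nths)
  then have "max_consistent D P \<le> hits (set ?xs) P"
    by (simp add: eq hits_def length_filter_conv_card)
  then have "max_consistent D P = hits (set ?xs) P"
    using hits_le_max_consistent[OF J(2)] le_antisym by blast
  then show thesis
    using that J(2) set_nths_subset by metis
qed

lemma preference_distance_eq:
  "real (preference_distance D P) = real (length P) - real (max_consistent D P)"
proof -
  have "max_consistent D P \<le> length P"
  \<comment> \<open>For empty \<open>D\<close> no index set qualifies and the default
    \<open>Sup {} = 0\<close> applies. The bound makes the truncated subtraction in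
    \<open>preference_distance\<close> exact.\<close>
  proof (cases "D = {}")
    case True
    then show ?thesis by (simp add: max_consistent_def belongs_to_iff)
  next
    case False
    then show ?thesis
      by (metis hits_def length_filter_le max_consistent_attained)
  qed
  then show ?thesis
    by (simp add: preference_distance_def max_consistent_def)
qed

section \<open>Counting linear orders and small sets of them\<close>

lemma finite_linear_orders: "finite A \<Longrightarrow> finite (linear_orders A)"
  unfolding linear_orders_def
  by (rule finite_subset[of _ "Pow (A \<times> A)"]) (auto simp: order_on_defs)

text \<open>A linear order is determined by the ranks of the elements.\<close>

lemma card_linear_orders_le:
  assumes "finite A"
  shows "card (linear_orders A) \<le> card A ^ card A"
proof -
  let ?rank = "\<lambda>r. \<lambda>a\<in>A. card {b\<in>A. (b, a) \<in> r}"
  have sub: "r \<subseteq> A \<times> A" if "r \<in> linear_orders A" for r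
    using that by (auto simp: linear_orders_def order_on_defs)
  have mem_iff: "(a, b) \<in> r \<longleftrightarrow> ?rank r a \<le> ?rank r b"
    if r: "r \<in> linear_orders A" and ab: "a \<in> A" "b \<in> A" for r a b
  proof
    have transr: "trans r"
      using r by (simp add: linear_orders_def order_on_defs)
    assume "(a, b) \<in> r"
    then show "?rank r a \<le> ?rank r b"
      using ab assms transr by (auto intro!: card_mono dest: transD)
  next
    assume le: "?rank r a \<le> ?rank r b"
    show "(a, b) \<in> r"
    proof (rule ccontr)
      assume n: "(a, b) \<notin> r"
      have refl: "(a, a) \<in> r"
        using r ab by (auto simp: linear_orders_def order_on_defs refl_on_def)
      then have "a \<noteq> b" using n by auto
      then have "(b, a) \<in> r"
        using r ab n by (auto simp: linear_orders_def order_on_defs total_on_def)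
      moreover have "trans r"
        using r by (simp add: linear_orders_def order_on_defs)
      \<comment> \<open>Inclusion is transitivity through \<open>(b, a)\<close>; it is strict
        because \<open>a\<close> lies in the right-hand set only.\<close>
      ultimately have "{c\<in>A. (c, b) \<in> r} \<subset> {c\<in>A. (c, a) \<in> r}"
        using ab n refl by (blast dest: transD)
      then have "card {c\<in>A. (c, b) \<in> r} < card {c\<in>A. (c, a) \<in> r}"
        using assms by (intro psubset_card_mono) auto
      then show False using le ab by simp
    qed
  qed
  have "inj_on ?rank (linear_orders A)"
  proof (rule inj_onI)
    fix r s assume rs: "r \<in> linear_orders A" "s \<in> linear_orders A" "?rank r = ?rank s"
    have "(a, b) \<in> r \<longleftrightarrow> (a, b) \<in> s" if "a \<in> A" "b \<in> A" for a b
      using mem_iff[OF rs(1) that] mem_iff[OF rs(2) that] rs(3) by simp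
    then show "r = s"
      using sub[OF rs(1)] sub[OF rs(2)] by auto
  qed
  \<comment> \<open>By reflexivity each element counts itself, so ranks start at 1 and take at most
    \<open>card A\<close> values.\<close>
  moreover have "?rank ` linear_orders A \<subseteq> A \<rightarrow>\<^sub>E {1..card A}"
  proof
    fix f assume "f \<in> ?rank ` linear_orders A"
    then obtain r where r: "r \<in> linear_orders A" and f: "f = ?rank r" by blast
    have "card {b\<in>A. (b, a) \<in> r} \<in> {1..card A}" if a: "a \<in> A" for a
    proof -
      have "a \<in> {b\<in>A. (b, a) \<in> r}"
        using r a by (auto simp: linear_orders_def order_on_defs refl_on_def)
      then have "card {b\<in>A. (b, a) \<in> r} > 0"
        using assms by (auto simp: card_gt_0_iff)
      moreover have "card {b\<in>A. (b, a) \<in> r} \<le> card A"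
        using assms by (intro card_mono) auto
      ultimately show ?thesis by auto
    qed
    then show "f \<in> A \<rightarrow>\<^sub>E {1..card A}"
      unfolding f by auto
  qed
  ultimately have "card (linear_orders A) \<le> card (A \<rightarrow>\<^sub>E {1..card A})"
    using assms by (intro card_inj_on_le finite_PiE) auto
  then show ?thesis
    using assms by (simp add: card_PiE)
qed

text \<open>\<open>Sup\<close> on the naturals is an upper bound only for bounded sets; here the
  number of linear orders supplies the bound.\<close>

lemma domain_content_ge:
  assumes "finite A" "A \<noteq> {}" "card A \<noteq> 1" "profile_on A P" "belongs_to P D"
  shows "real (card (set P)) \<le> domain_content D (card A) * fact (card A)"
proof -
  let ?m = "card A"
  let ?C = "{card (set P) | P A. finite A \<and> card A = ?m \<and> A \<noteq> {} \<and>
                                  profile_on A P \<and> belongs_to P D}"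
  have "card (set Q) \<le> ?m ^ ?m"
    if "finite B" "card B = ?m" "profile_on B Q" for Q and B :: "'a set"
    using that card_mono[OF finite_linear_orders, of B "set Q"] card_linear_orders_le[of B]
    by (auto simp: profile_on_def)
  then have "bdd_above ?C"
    by (intro bdd_aboveI[of _ "?m ^ ?m"]) auto
  moreover have "card (set P) \<in> ?C"
    using assms by blast
  ultimately have "card (set P) \<le> Sup ?C"
    by (rule cSup_upper[rotated])
  then show ?thesis
    using assms(3) by (simp add: domain_content_def)
qed

text \<open>Allows the content times \<open>m!\<close> to serve as the length of tuples and as an
  exponent.\<close>

lemma domain_content_nat:
  assumes "m \<noteq> 1"
  obtains c :: nat where "domain_content D m * fact m = real c"
  using assms by (simp add: domain_content_def)

lemma card_bounded_subsets_le:
  assumes "finite X"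
  shows "card {S. S \<subseteq> X \<and> S \<noteq> {} \<and> card S \<le> c} \<le> card X ^ c"
proof -
  have "{S. S \<subseteq> X \<and> S \<noteq> {} \<and> card S \<le> c} \<subseteq> set ` {xs. set xs \<subseteq> X \<and> length xs = c}"
  proof
    fix S assume "S \<in> {S. S \<subseteq> X \<and> S \<noteq> {} \<and> card S \<le> c}"
    then have S: "S \<subseteq> X" "S \<noteq> {}" "card S \<le> c" by auto
    then obtain ys where ys: "set ys = S" "distinct ys"
      using assms finite_distinct_list finite_subset by metis
    obtain a where a: "a \<in> S" using S(2) by blast
    \<comment> \<open>Repeating one element pads the list to length exactly \<open>c\<close>; this
      is where \<open>S\<close> must be nonempty.\<close>
    let ?xs = "ys @ replicate (c - card S) a"
    have "set ?xs = S" "length ?xs = c"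
      using ys a S(3) distinct_card[OF ys(2)] by auto
    then show "S \<in> set ` {xs. set xs \<subseteq> X \<and> length xs = c}"
      using S(1) by (intro image_eqI[of _ _ ?xs]) auto
  qed
  then have "card {S. S \<subseteq> X \<and> S \<noteq> {} \<and> card S \<le> c} \<le> card {xs. set xs \<subseteq> X \<and> length xs = c}"
    using assms by (intro surj_card_le finite_lists_length_eq)
  then show ?thesis
    using assms by (simp add: card_lists_length_eq)
qed

section \<open>Tail bounds for the frequency of a fixed set in the sample\<close>

lemma map_replicate_pmf: "map_pmf (map f) (replicate_pmf l p) = replicate_pmf l (map_pmf f p)"
proof (induction l)
  case (Suc l)
  show ?case
    unfolding replicate_pmf.simps Suc[symmetric]
    by (simp add: map_pmf_def bind_return_pmf bind_assoc_pmf)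
qed simp

lemma map_pmf_mem_eq_bernoulli_pmf:
  "map_pmf (\<lambda>x. x \<in> S) p = bernoulli_pmf (measure_pmf.prob p S)"
proof (rule pmf_eqI)
  fix b
  have "(\<lambda>x. x \<in> S) -` {b} = (if b then S else UNIV - S)" by auto
  then show "pmf (map_pmf (\<lambda>x. x \<in> S) p) b = pmf (bernoulli_pmf (measure_pmf.prob p S)) b"
    using measure_pmf.prob_compl[of S p] by (simp add: pmf_map)
qed

text \<open>Only the indicator of \<open>S\<close> at each draw matters, and these indicators are
  independent Bernoulli variables with a common parameter.\<close>

lemma map_pmf_hits_replicate_pmf:
  "map_pmf (hits S) (replicate_pmf l p) = binomial_pmf l (measure_pmf.prob p S)"
proof -
  have "map_pmf (hits S) (replicate_pmf l p) =
      map_pmf (length \<circ> filter id) (map_pmf (map (\<lambda>x. x \<in> S)) (replicate_pmf l p))"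
    by (simp add: pmf.map_comp o_def hits_def filter_map id_def cong: map_pmf_cong)
  also have "\<dots> = map_pmf (length \<circ> filter id)
      (replicate_pmf l (bernoulli_pmf (measure_pmf.prob p S)))"
    by (simp add: map_replicate_pmf map_pmf_mem_eq_bernoulli_pmf)
  also have "\<dots> = binomial_pmf l (measure_pmf.prob p S)"
    by (subst binomial_pmf_altdef) auto
  finally show ?thesis .
qed

lemma prob_sample_index:
  assumes "P \<noteq> []"
  shows "measure_pmf.prob (map_pmf (\<lambda>i. P ! i) (pmf_of_set {..<length P})) S =
           real (hits S P) / real (length P)"
  using assms
  by (simp add: measure_pmf_of_set hits_def length_filter_conv_card lessThan_empty_iff
      Int_def vimage_def conj_commute)

text \<open>Hoeffding's inequality for the binomial count of hits, whose success probability is the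
  frequency of \<open>S\<close> in \<open>P\<close>.\<close>

lemma
  assumes "P \<noteq> []" "0 < l" "0 \<le> \<Delta>"
  shows prob_hits_ge: "measure_pmf.prob (sample_profile l P)
      {Q. real (hits S Q) \<ge> (real (hits S P) / real (length P) + \<Delta>) * real l} \<le> exp (-2 * real l * \<Delta>\<^sup>2)"
    and prob_hits_le: "measure_pmf.prob (sample_profile l P)
      {Q. real (hits S Q) \<le> (real (hits S P) / real (length P) - \<Delta>) * real l} \<le> exp (-2 * real l * \<Delta>\<^sup>2)"
proof -
  let ?q = "real (hits S P) / real (length P)"
  have bin: "map_pmf (hits S) (sample_profile l P) = binomial_pmf l ?q"
    unfolding sample_profile_def map_pmf_hits_replicate_pmf prob_sample_index[OF assms(1)] ..
  have q: "?q \<in> {0..1}"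
    using assms(1) by (auto simp: hits_def)
  interpret binomial_distribution l ?q by unfold_locales (rule q)
  have "measure_pmf.prob (sample_profile l P) {Q. real (hits S Q) \<ge> (?q + \<Delta>) * real l} =
      measure_pmf.prob (binomial_pmf l ?q) {x. x / l \<ge> ?q + \<Delta>}"
    using assms(2) by (simp add: bin[symmetric] vimage_def pos_le_divide_eq)
  also have "\<dots> \<le> exp (-2 * real l * \<Delta>\<^sup>2)"
    using prob_ge' assms by simp
  finally show "measure_pmf.prob (sample_profile l P)
      {Q. real (hits S Q) \<ge> (?q + \<Delta>) * real l} \<le> exp (-2 * real l * \<Delta>\<^sup>2)" .
  have "measure_pmf.prob (sample_profile l P) {Q. real (hits S Q) \<le> (?q - \<Delta>) * real l} =
      measure_pmf.prob (binomial_pmf l ?q) {x. x / l \<le> ?q - \<Delta>}"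
    using assms(2) by (simp add: bin[symmetric] vimage_def pos_divide_le_eq)
  also have "\<dots> \<le> exp (-2 * real l * \<Delta>\<^sup>2)"
    using prob_le' assms by simp
  finally show "measure_pmf.prob (sample_profile l P)
      {Q. real (hits S Q) \<le> (?q - \<Delta>) * real l} \<le> exp (-2 * real l * \<Delta>\<^sup>2)" .
qed

lemma set_sample_profile:
  assumes "Q \<in> set_pmf (sample_profile l P)" "P \<noteq> []"
  shows "length Q = l" "set Q \<subseteq> set P"
  using assms by (auto simp: sample_profile_def set_replicate_pmf
      lessThan_empty_iff in_lists_conv_set)


section \<open>Concentration of the preference-distance of the sample\<close>

theorem lemma3p7:
  fixes D :: "'a rel set set" and A :: "'a set" and P :: "'a rel list"
    and m n l :: nat and \<epsilon>\<^sub>v \<Delta> \<delta> :: real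
  assumes "preference_domain D" and "normal_domain D" and "neutral_domain D"
    and "finite A" and "card A = m" and "m \<ge> 1"
    and "profile_on A P" and "length P = n" and "n \<ge> 1"
    and "real (preference_distance D P) = \<epsilon>\<^sub>v * real n"
    and "0 < \<Delta>" and "\<Delta> < min \<epsilon>\<^sub>v (1 - \<epsilon>\<^sub>v)"
    and "0 < \<delta>" and "\<delta> < 1"
    and "l = nat \<lceil>4 / \<Delta>\<^sup>2 * (domain_content D m * fact m * real m * ln (real m) + ln (1 / \<delta>))\<rceil>"
  shows "measure_pmf.prob (sample_profile l P)
           {Q. (\<epsilon>\<^sub>v - \<Delta>) * real l \<le> real (preference_distance D Q) \<and>
               real (preference_distance D Q) \<le> (\<epsilon>\<^sub>v + \<Delta>) * real l} \<ge> 1 - \<delta>"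
proof -
  note eps = assms(10) and bounds = assms(11-14) and l = assms(15)
  let ?M = "real (max_consistent D P)"
  have P: "P \<noteq> []" using assms(8,9) by auto
  have kept: "?M / real n = 1 - \<epsilon>\<^sub>v"
    using eps assms(8,9) by (simp add: preference_distance_eq field_simps)
  \<comment> \<open>The bound on \<open>\<Delta>\<close> puts \<open>\<epsilon>\<^sub>v\<close>
    strictly between 0 and 1. This excludes the degenerate cases: an empty domain, an empty optimal
    set and a single alternative.\<close>
  have M_lt: "max_consistent D P < n" and M_pos: "max_consistent D P > 0"
  proof -
    have "0 < ?M / real n" "?M / real n < 1"
      using kept bounds by auto
    then show "max_consistent D P < n" "max_consistent D P > 0"
      using assms(9) by (auto simp: zero_less_divide_iff field_simps)
  qed
  have D: "D \<noteq> {}"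
    using M_pos by (auto simp: max_consistent_def belongs_to_iff)
  obtain xs where xs: "belongs_to xs D" "set xs \<subseteq> set P" "max_consistent D P = hits (set xs) P"
    using max_consistent_attained[OF D] .
  have "xs \<noteq> []"
    using xs(3) M_pos by (auto simp: hits_def)
  have A: "A \<noteq> {}" using assms(5,6) by auto
  have L: "set P \<subseteq> linear_orders A"
    using assms(7) by (simp add: profile_on_def)
  \<comment> \<open>With one alternative all entries of \<open>P\<close> coincide, so the nonempty
    \<open>xs\<close> would keep the whole profile.\<close>
  have "m \<noteq> 1"
  proof
    assume "m = 1"
    then have "card (linear_orders A) \<le> 1"
      using card_linear_orders_le[OF assms(4)] assms(5) by simp
    then have "set P \<subseteq> set xs"
      using L xs(2) \<open>xs \<noteq> []\<close> finite_linear_orders[OF assms(4)]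
      by (metis card_le_Suc0_iff_eq One_nat_def list.set_intros(1) neq_Nil_conv subset_iff)
    then have "filter (\<lambda>r. r \<in> set xs) P = P"
      by (auto simp: filter_id_conv)
    then show False
      using xs(3) M_lt assms(8) by (simp add: hits_def)
  qed
  then have m: "m \<ge> 2" using assms(6) by simp
  obtain c where c: "domain_content D m * fact m = real c"
    using domain_content_nat[OF \<open>m \<noteq> 1\<close>] .
  have card_le_c: "card (set ys) \<le> c" if "belongs_to ys D" "set ys \<subseteq> set P" for ys
  proof -
    have "profile_on A ys" using that L by (auto simp: profile_on_def)
    then show ?thesis
      using domain_content_ge[of A ys D] that assms(4,5) A c \<open>m \<noteq> 1\<close> by simp
  qed
  have "c \<ge> 1"
    using card_le_c[OF xs(1,2)] \<open>xs \<noteq> []\<close>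
    by (metis List.finite_set card_gt_0_iff less_one linorder_not_le set_empty)

  \<comment> \<open>The candidates for an optimal set of a sample, which draws from
    \<open>set P\<close> only. The empty set is left out to fit the tuple count.\<close>
  define F where "F = {S. \<exists>ys. S = set ys \<and> ys \<noteq> [] \<and> belongs_to ys D \<and> set ys \<subseteq> set P}"
  \<comment> \<open>The bound \<open>(m ^ m) ^ c\<close> on the number of candidates; its logarithm
    is the content term in \<open>l\<close>.\<close>
  define N :: nat where "N = m ^ (m * c)"
  have fin: "finite F"
    by (rule finite_subset[of _ "Pow (set P)"]) (auto simp: F_def)
  have "card F \<le> card {S. S \<subseteq> linear_orders A \<and> S \<noteq> {} \<and> card S \<le> c}"
    using L card_le_c finite_linear_orders[OF assms(4)]
    by (intro card_mono) (auto simp: F_def)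
  also have "\<dots> \<le> card (linear_orders A) ^ c"
    by (rule card_bounded_subsets_le[OF finite_linear_orders[OF assms(4)]])
  also have "\<dots> \<le> (m ^ m) ^ c"
    using card_linear_orders_le[OF assms(4)] assms(5) by (intro power_mono) auto
  finally have card_F: "card F \<le> N"
    by (simp add: N_def power_mult)
  have "m ^ 1 \<le> m ^ (m * c)"
    using m \<open>c \<ge> 1\<close> by (intro power_increasing) simp_all
  then have N: "N \<ge> 2" using m by (simp add: N_def)

  let ?X = "ln (real N) + ln (1 / \<delta>)"
  have X_pos: "?X > 0"
    using N bounds by (intro add_pos_pos) auto
  have "domain_content D m * fact m * real m * ln (real m) = ln (real N)"
    using m by (simp add: c N_def ln_realpow)
  then have l_eq: "l = nat \<lceil>4 / \<Delta>\<^sup>2 * ?X\<rceil>" using l by simp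
  have l_ge: "4 / \<Delta>\<^sup>2 * ?X \<le> real l"
    unfolding l_eq by linarith
  have "0 < 4 / \<Delta>\<^sup>2 * ?X" using X_pos bounds by simp
  then have l_pos: "0 < l" using l_ge by linarith
  define e where "e = exp (-2 * real l * \<Delta>\<^sup>2)"
  \<comment> \<open>The exponent \<open>2 * l * \<Delta>^2\<close> is thus at least
    \<open>8 * ?X\<close>, of which only \<open>2 * ?X\<close> is used. The resulting square of
    \<open>\<delta> / N\<close> absorbs the additional lower-tail event, since
    \<open>N + 1 \<le> N * N\<close> for \<open>N \<ge> 2\<close>.\<close>
  have "4 * ?X \<le> real l * \<Delta>\<^sup>2"
    using l_ge bounds by (simp add: field_simps)
  then have "e \<le> exp (- (?X + ?X))"
    unfolding e_def using X_pos by simp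
  also have "\<dots> = exp (- ?X) * exp (- ?X)"
    by (simp flip: exp_add)
  also have "exp (- ?X) = \<delta> / real N"
    using N bounds by (simp add: exp_diff exp_minus ln_div field_simps)
  finally have e_le: "e \<le> (\<delta> / real N) * (\<delta> / real N)" .
  have "(real N + 1) * e \<le> (real N * real N) * ((\<delta> / real N) * (\<delta> / real N))"
  proof (intro mult_mono e_le)
    have "2 * real N \<le> real N * real N" using N by (intro mult_right_mono) auto
    then show "real N + 1 \<le> real N * real N" using N by linarith
  qed (auto simp: e_def)
  also have "\<dots> = \<delta> * \<delta>" using N by (simp add: field_simps)
  also have "\<dots> \<le> \<delta>" using bounds by (simp add: mult_left_le)
  finally have e_bound: "(real N + 1) * e \<le> \<delta>" .

  let ?p = "sample_profile l P"
  let ?hi = "\<lambda>S. {Q. real (hits S Q) \<ge> (real (hits S P) / real (length P) + \<Delta>) * real l}"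
  let ?lo = "{Q. real (hits (set xs) Q) \<le>
                 (real (hits (set xs) P) / real (length P) - \<Delta>) * real l}"
  let ?good = "{Q. (\<epsilon>\<^sub>v - \<Delta>) * real l \<le> real (preference_distance D Q) \<and>
                   real (preference_distance D Q) \<le> (\<epsilon>\<^sub>v + \<Delta>) * real l}"
  have bad: "Q \<in> (\<Union>S\<in>F. ?hi S) \<union> ?lo" if Q: "Q \<in> set_pmf ?p" and "Q \<notin> ?good" for Q
  proof -
    note QP = set_sample_profile[OF Q P]
    have dist: "real (preference_distance D Q) = real l - real (max_consistent D Q)"
      by (simp add: preference_distance_eq QP(1))
    consider "real (preference_distance D Q) < (\<epsilon>\<^sub>v - \<Delta>) * real l"
      | "real (preference_distance D Q) > (\<epsilon>\<^sub>v + \<Delta>) * real l"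
      using \<open>Q \<notin> ?good\<close> by fastforce
    then show ?thesis
    proof cases
      \<comment> \<open>Too small a distance: the optimal set \<open>ys\<close> of the sample is too
        frequent in \<open>Q\<close>. It varies with \<open>Q\<close>, hence the union over
        \<open>F\<close>.\<close>
      case 1
      obtain ys where ys: "belongs_to ys D" "set ys \<subseteq> set Q"
        "max_consistent D Q = hits (set ys) Q"
        using max_consistent_attained[OF D] .
      have "real (hits (set ys) P) / real n \<le> ?M / real n"
        using hits_le_max_consistent[OF ys(1)] by (simp add: divide_right_mono)
      then have "(real (hits (set ys) P) / real n + \<Delta>) * real l \<le> (1 - \<epsilon>\<^sub>v + \<Delta>) * real l"
        by (intro mult_right_mono) (auto simp: kept)
      also have lt: "\<dots> < real (hits (set ys) Q)"
        using 1 dist ys(3) by (simp add: algebra_simps)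
      finally have "Q \<in> ?hi (set ys)"
        by (simp add: assms(8))
      \<comment> \<open>An empty \<open>ys\<close> would have no hits, but the hits exceed this
        nonnegative bound.\<close>
      moreover have "0 \<le> (1 - \<epsilon>\<^sub>v + \<Delta>) * real l"
        using bounds by (intro mult_nonneg_nonneg) auto
      then have "ys \<noteq> []"
        using lt by (auto simp: hits_def)
      then have "set ys \<in> F"
        using ys(1,2) QP(2) by (auto simp: F_def)
      ultimately show ?thesis by blast
    next
      \<comment> \<open>Too large a distance: even the fixed set \<open>xs\<close>, optimal for
        \<open>P\<close>, is too rare in \<open>Q\<close>, so one event suffices.\<close>
      case 2
      then have "real (max_consistent D Q) < (?M / real n - \<Delta>) * real l"
        using dist by (simp add: kept algebra_simps)
      then have "Q \<in> ?lo"
        using hits_le_max_consistent[OF xs(1), of Q] xs(3) assms(8) by simp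
      then show ?thesis by blast
    qed
  qed
  \<comment> \<open>The inclusion \<open>bad\<close> holds on the support of the sample only, so
    monotonicity is applied almost everywhere.\<close>
  have "measure_pmf.prob ?p (- ?good) \<le> measure_pmf.prob ?p ((\<Union>S\<in>F. ?hi S) \<union> ?lo)"
    by (rule measure_pmf.finite_measure_mono_AE) (auto simp: AE_measure_pmf_iff dest: bad)
  also have "\<dots> \<le> measure_pmf.prob ?p (\<Union>S\<in>F. ?hi S) + measure_pmf.prob ?p ?lo"
    by (rule measure_Un_le) auto
  also have "\<dots> \<le> (\<Sum>S\<in>F. measure_pmf.prob ?p (?hi S)) + measure_pmf.prob ?p ?lo"
    by (intro add_right_mono measure_UNION_le fin) auto
  also have "\<dots> \<le> (\<Sum>S\<in>F. e) + e"
    unfolding e_def using bounds by (intro add_mono sum_mono prob_hits_ge prob_hits_le P l_pos) auto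
  also have "\<dots> = (real (card F) + 1) * e" by (simp add: algebra_simps)
  also have "\<dots> \<le> (real N + 1) * e"
    using card_F by (intro mult_right_mono) (auto simp: e_def)
  also note e_bound
  finally have "measure_pmf.prob ?p (- ?good) \<le> \<delta>" .
  then show ?thesis
    using measure_pmf.prob_compl[of ?good ?p] by (simp add: Compl_eq_Diff_UNIV)
qed

end
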